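(* Let $n\ge 1$. The smallest size of a multiplicatively quasi-dense subset of $G_n$ is $n+2$, and the smallest size of a multiplicatively dense subset of $G_n$ is also $n+2$.
   Context: $G_n$ is the matrix Lie group $\left\{\begin{pmatrix} a & \mathbf b\\ 0 & I_n\end{pmatrix} : \mathbf b\in\mathbb{R}^n,\ a>0\right\}$. Replacing the coordinate $a$ by its natural logarithm, $G_n$ is identified with $\mathbb{R}\times\mathbb{R}^n$ with product $(a,\mathbf b)(a',\mathbf b')=(a+a',\mathbf b+e^{a}\mathbf b')$. A subset $S$ of a Lie group is multiplicatively quasi-dense if the closure of the semigroup it generates is a group that is not contained in any connected codimension 1 subgroup. A subset $S$ of a topological group is multiplicatively dense if the subsemigroup it generates is dense. *)

theory Defs
  imports "HOL-Analysis.Analysis" "HOL-Algebra.Group"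
begin

section \<open>The Lie group $G_n$\<close>

text \<open>
  The group \<open>G\<^sub>n\<close> in logarithmic coordinates, with \<open>n = CARD('n)\<close>. Its topology is the
  one of the type \<^typ>\<open>real \<times> (real ^ 'n)\<close>. The link with the matrix group is made by
  \<open>Gn_matrix\<close> and the lemmas about it.
\<close>

definition Gn :: "(real \<times> (real ^ 'n)) monoid" where
  "Gn = \<lparr>carrier = UNIV,
         monoid.mult = (\<lambda>(a, b) (a', b'). (a + a', b + exp a *\<^sub>R b')),
         one = (0, 0)\<rparr>"

lemma carrier_Gn [simp]: "carrier Gn = UNIV"
  by (simp add: Gn_def)

lemma mult_Gn [simp]: "(a, b) \<otimes>\<^bsub>Gn\<^esub> (a', b') = (a + a', b + exp a *\<^sub>R b')"
  by (simp add: Gn_def)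

lemma one_Gn [simp]: "\<one>\<^bsub>Gn\<^esub> = (0, 0)"
  by (simp add: Gn_def)

lemma group_Gn: "group (Gn :: (real \<times> (real ^ 'n)) monoid)"
proof (rule groupI)
  fix x :: "real \<times> (real ^ 'n)"
  obtain a b where x: "x = (a, b)" by (cases x)
  have "(- a, - (exp (- a) *\<^sub>R b)) \<otimes>\<^bsub>Gn\<^esub> x = \<one>\<^bsub>Gn\<^esub>"
    by (simp add: x)
  then show "\<exists>y\<in>carrier Gn. y \<otimes>\<^bsub>Gn\<^esub> x = \<one>\<^bsub>Gn\<^esub>"
    by auto
qed (auto simp: exp_add algebra_simps)

lemma inv_Gn: "inv\<^bsub>Gn\<^esub> (a, b) = (- a, - (exp (- a) *\<^sub>R b))"
  by (rule group.inv_equality[OF group_Gn]) auto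

text \<open>Rows and columns are indexed by \<^typ>\<open>'n option\<close>, with \<^const>\<open>None\<close> as the first index.\<close>

definition Gn_matrix :: "real \<times> (real ^ 'n) \<Rightarrow> real ^ ('n option) ^ ('n option)" where
  "Gn_matrix = (\<lambda>(a, b). \<chi> i j. case i of
      None \<Rightarrow> (case j of None \<Rightarrow> exp a | Some k \<Rightarrow> b $ k)
    | Some l \<Rightarrow> (case j of None \<Rightarrow> 0 | Some k \<Rightarrow> if l = k then 1 else 0))"

lemma sum_UNIV_option:
  fixes f :: "'n::finite option \<Rightarrow> real"
  shows "(\<Sum>i\<in>UNIV. f i) = f None + (\<Sum>k\<in>UNIV. f (Some k))"
  by (simp add: UNIV_option_conv sum.reindex)

lemma Gn_matrix_mult: "Gn_matrix (x \<otimes>\<^bsub>Gn\<^esub> y) = Gn_matrix x ** Gn_matrix y"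
  by (cases x; cases y)
    (auto simp: Gn_matrix_def matrix_matrix_mult_def vec_eq_iff sum_UNIV_option exp_add
      if_distrib if_distribR sum.delta cong: if_cong split: option.splits)

lemma range_Gn_matrix:
  "range (Gn_matrix :: real \<times> (real ^ 'n) \<Rightarrow> _) =
    {M. M $ None $ None > 0 \<and> (\<forall>l. M $ Some l $ None = 0) \<and>
        (\<forall>l k. M $ Some l $ Some k = (if l = k then 1 else 0))}" (is "_ = ?R")
proof
  show "range Gn_matrix \<subseteq> ?R"
    by (auto simp: Gn_matrix_def)
  show "?R \<subseteq> range Gn_matrix"
  proof
    fix M :: "real ^ ('n option) ^ ('n option)" assume "M \<in> ?R"
    then have "M = Gn_matrix (ln (M $ None $ None), \<chi> k. M $ None $ Some k)"
      by (auto simp: Gn_matrix_def vec_eq_iff split: option.splits)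
    then show "M \<in> range Gn_matrix" by blast
  qed
qed

lemma Gn_matrix_inverse:
  "(ln (Gn_matrix x $ None $ None), \<chi> k. Gn_matrix x $ None $ Some k) = x"
  by (cases x) (simp add: Gn_matrix_def vec_eq_iff)

lemma homeomorphism_Gn_matrix:
  "homeomorphism UNIV (range Gn_matrix) (Gn_matrix :: real \<times> (real ^ 'n) \<Rightarrow> _)
    (\<lambda>M. (ln (M $ None $ None), \<chi> k. M $ None $ Some k))"
proof (rule homeomorphismI)
  show "continuous_on UNIV (Gn_matrix :: real \<times> (real ^ 'n) \<Rightarrow> _)"
    unfolding Gn_matrix_def case_prod_beta
  proof (intro continuous_on_vec_lambda)
    show "continuous_on UNIV (\<lambda>x :: real \<times> (real ^ 'n). case i of
        None \<Rightarrow> (case j of None \<Rightarrow> exp (fst x) | Some k \<Rightarrow> snd x $ k)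
      | Some l \<Rightarrow> (case j of None \<Rightarrow> 0 | Some k \<Rightarrow> if l = k then 1 else 0))" for i j
      by (cases i; cases j) (auto intro!: continuous_intros)
  qed
  show "continuous_on (range (Gn_matrix :: real \<times> (real ^ 'n) \<Rightarrow> _))
      (\<lambda>M. (ln (M $ None $ None), \<chi> k. M $ None $ Some k))"
    unfolding range_Gn_matrix
    by (intro continuous_on_Pair continuous_on_vec_lambda continuous_intros) auto
qed (auto simp: Gn_matrix_inverse)


section \<open>Connected subgroups of codimension 1\<close>

text \<open>For open \<open>V\<close>, \<open>Ck_on k V f\<close> says that \<open>f\<close> is of class $C^k$ on \<open>V\<close>.\<close>

primrec Ck_on :: "nat \<Rightarrow> 'a::euclidean_space set \<Rightarrow> ('a \<Rightarrow> 'b::euclidean_space) \<Rightarrow> bool" where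
  "Ck_on 0 V f \<longleftrightarrow> continuous_on V f"
| "Ck_on (Suc k) V f \<longleftrightarrow>
    (\<forall>x\<in>V. f differentiable (at x)) \<and> (\<forall>v. Ck_on k V (\<lambda>x. frechet_derivative f (at x) v))"

definition smooth_immersion_on ::
  "'a::euclidean_space set \<Rightarrow> ('a \<Rightarrow> 'b::euclidean_space) \<Rightarrow> bool" where
  "smooth_immersion_on V f \<longleftrightarrow>
    (\<forall>k. Ck_on k V f) \<and> (\<forall>x\<in>V. inj (frechet_derivative f (at x)))"

text \<open>
  Subgroups of a Lie group are understood as Lie subgroups, i.e.\ immersed submanifolds that
  are subgroups. \<open>T\<close> is the intrinsic topology of \<open>H\<close>, which may a priori be finer than the
  subspace topology, and \<open>\<phi>\<close> are inverse charts, with values in the ambient group. Since they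
  are smooth immersions into the ambient group, changes of charts are automatically smooth,
  and so are the group operations of \<open>H\<close> once they are continuous with respect to \<open>T\<close>.
  Charts are modelled on \<^typ>\<open>real ^ 'n\<close>, so \<open>H\<close> has dimension \<open>n\<close>, which is codimension 1.
\<close>

definition connected_codim1_subgroup :: "(real \<times> (real ^ 'n)) set \<Rightarrow> bool" where
  "connected_codim1_subgroup H \<longleftrightarrow>
    subgroup H Gn \<and>
    (\<exists>T. topspace T = H \<and> connected_space T \<and> Hausdorff_space T \<and> second_countable T \<and>
      continuous_map (prod_topology T T) T (\<lambda>(x, y). x \<otimes>\<^bsub>Gn\<^esub> y) \<and>
      continuous_map T T (\<lambda>x. inv\<^bsub>Gn\<^esub> x) \<and>
      (\<forall>p\<in>H. \<exists>(V :: (real ^ 'n) set) \<phi>. open V \<and> p \<in> \<phi> ` V \<and> openin T (\<phi> ` V) \<and>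
        homeomorphic_map (top_of_set V) (subtopology T (\<phi> ` V)) \<phi> \<and>
        smooth_immersion_on V \<phi>))"


section \<open>Multiplicative density and quasi-density\<close>

inductive_set semigroup_span :: "('a, 'm) monoid_scheme \<Rightarrow> 'a set \<Rightarrow> 'a set"
  for G and S where
  base: "x \<in> S \<Longrightarrow> x \<in> semigroup_span G S"
| mult: "x \<in> semigroup_span G S \<Longrightarrow> y \<in> semigroup_span G S \<Longrightarrow>
    x \<otimes>\<^bsub>G\<^esub> y \<in> semigroup_span G S"

definition mult_dense :: "(real \<times> (real ^ 'n)) set \<Rightarrow> bool" where
  "mult_dense S \<longleftrightarrow> closure (semigroup_span Gn S) = UNIV"

definition mult_quasi_dense :: "(real \<times> (real ^ 'n)) set \<Rightarrow> bool" where
  "mult_quasi_dense S \<longleftrightarrow>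
    subgroup (closure (semigroup_span Gn S)) Gn \<and>
    \<not> (\<exists>H. connected_codim1_subgroup H \<and> closure (semigroup_span Gn S) \<subseteq> H)"

definition smallest_size :: "('a set \<Rightarrow> bool) \<Rightarrow> nat \<Rightarrow> bool" where
  "smallest_size P k \<longleftrightarrow>
    (\<exists>S. finite S \<and> card S = k \<and> P S) \<and> (\<forall>S. finite S \<and> P S \<longrightarrow> k \<le> card S)"

end

theory Submission
  imports Defs
begin

text \<open>
  Write an element of \<open>G\<^sub>n\<close> as \<open>x = (a, b)\<close> and put \<open>v x = (1 - exp a, b)\<close>, a vector of the
  \<open>(n+1)\<close>-dimensional space \<open>\<real> \<times> \<real>\<^sup>n\<close>. The map \<open>v\<close> is a cocycle,
  \<open>v (x y) = v x + exp a \<cdot> v y\<close>, so for every linear form \<open>f\<close> the real function \<open>f \<circ> v\<close> satisfies the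
  same rule. Two facts follow. If \<open>f \<noteq> 0\<close>, the zero set of \<open>f \<circ> v\<close> is a subgroup, and it is a
  connected Lie subgroup of codimension 1 because it is either \<open>{0} \<times> \<real>\<^sup>n\<close> or a graph over
  \<open>n\<close> of the coordinates. And if \<open>f \<circ> v\<close> is positive on a set \<open>S\<close>, it is nonnegative on the closure
  of the semigroup generated by \<open>S\<close>, which therefore contains no inverse of an element of \<open>S\<close>.

  Lower bound (\<open>card_ge_if_mult_quasi_dense\<close>): let \<open>S\<close> have at most \<open>n + 1\<close> elements. Either \<open>v ` S\<close>
  does not span, so that some \<open>f \<noteq> 0\<close> vanishes on it and \<open>S\<close> lies in a codimension 1 subgroup;
  or \<open>v ` S\<close> is a basis, so that some \<open>f\<close> equals 1 on all of it and the closed semigroup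
  generated by \<open>S\<close> is not a group. In both cases \<open>S\<close> is not quasi-dense. Dense sets are
  quasi-dense because a subgroup of codimension 1, being covered by countably many smooth images of
  open subsets of \<open>\<real>\<^sup>n\<close>, is a null set.

  Upper bound (\<open>mult_dense_simplex_generators\<close>): let the element \<open>(a, b)\<close> act on \<open>\<real>\<^sup>n\<close> as the
  similarity \<open>y \<mapsto> exp a \<cdot> y + b\<close>. Take the \<open>n + 1\<close> contractions of ratio \<open>r = n / (n+1)\<close> towards
  the vertices of a simplex with 0 in its interior. Their images of the simplex cover it, hence
  the translation parts of the words of length \<open>k\<close> are dense in the simplex up to an error of order
  \<open>r ^ k\<close>. Multiplying such a word on the right by a power of one further element, a
  pure dilation, changes its ratio but not its translation part. If the logarithms of the two
  ratios are incommensurable and of opposite sign, every \<open>(a, b)\<close> with \<open>b\<close> in the simplex is a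
  limit of such products, and the elements \<open>(a, 0)\<close> together with those for small \<open>b\<close>
  already generate the whole group.
\<close>

section \<open>The cocycle and the codimension 1 subgroups\<close>

definition cocycle :: "real \<times> (real ^ 'n) \<Rightarrow> real \<times> (real ^ 'n)" where
  "cocycle x = (1 - exp (fst x), snd x)"

lemma cocycle_mult: "cocycle (x \<otimes>\<^bsub>Gn\<^esub> y) = cocycle x + exp (fst x) *\<^sub>R cocycle y"
  by (cases x; cases y) (simp add: cocycle_def exp_add algebra_simps)

lemma cocycle_inv: "cocycle (inv\<^bsub>Gn\<^esub> x) = - (exp (- fst x) *\<^sub>R cocycle x)"
  by (cases x) (simp add: cocycle_def inv_Gn algebra_simps flip: exp_add)

lemma continuous_on_cocycle: "continuous_on A cocycle"
  unfolding cocycle_def by (intro continuous_intros)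

definition cocycle_kernel :: "real \<times> (real ^ 'n) \<Rightarrow> (real \<times> (real ^ 'n)) set" where
  "cocycle_kernel w = {x. w \<bullet> cocycle x = 0}"

lemma subgroup_cocycle_kernel: "subgroup (cocycle_kernel w) Gn"
proof
  show "\<one>\<^bsub>Gn\<^esub> \<in> cocycle_kernel w"
    by (simp add: cocycle_kernel_def cocycle_def flip: zero_prod_def)
qed (auto simp: cocycle_kernel_def cocycle_mult cocycle_inv inner_add_right
      simp del: mult_Gn split_paired_All)

lemma closed_cocycle_kernel: "closed (cocycle_kernel w)"
  unfolding cocycle_kernel_def
  by (intro closed_Collect_eq continuous_intros continuous_on_cocycle)

text \<open>
  The functions below contain the charts that are needed and, up to the choice of the parameters,
  all their directional derivatives. This makes the class stable under the recursion that
  defines smoothness.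
\<close>

lemma has_derivative_affine_plus_exp:
  fixes L :: "real ^ 'n \<Rightarrow> 'b::euclidean_space"
  assumes "linear L"
  shows "((\<lambda>x. u + L x + exp (x $ i) *\<^sub>R w) has_derivative
    (\<lambda>h. L h + exp (x $ i) *\<^sub>R ((h $ i) *\<^sub>R w))) (at x)"
proof -
  have "(L has_derivative L) (at x)"
    using assms by (simp add: linear_imp_has_derivative)
  moreover have "((\<lambda>x. x $ i) has_derivative (\<lambda>h. h $ i)) (at x)"
    by (simp add: bounded_linear_vec_nth bounded_linear_imp_has_derivative)
  ultimately show ?thesis
    by (auto intro!: derivative_eq_intros simp: algebra_simps)
qed

lemma Ck_on_affine_plus_exp:
  fixes L :: "real ^ 'n \<Rightarrow> 'b::euclidean_space"
  assumes "linear L"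
  shows "Ck_on k V (\<lambda>x. u + L x + exp (x $ i) *\<^sub>R w)"
  using assms
proof (induction k arbitrary: L u w)
  case 0
  then show ?case
    using has_derivative_continuous[OF has_derivative_affine_plus_exp[OF 0]]
    by (simp add: continuous_at_imp_continuous_on)
next
  case (Suc k)
  note D = has_derivative_affine_plus_exp[OF Suc.prems]
  have "Ck_on k V (\<lambda>x. L h + exp (x $ i) *\<^sub>R ((h $ i) *\<^sub>R w))" for h
    using Suc.IH[of "\<lambda>_. 0" "L h" "(h $ i) *\<^sub>R w"] by (simp add: linear_zero)
  moreover have "(\<lambda>x. u + L x + exp (x $ i) *\<^sub>R w) differentiable (at x)" for x
    using D unfolding differentiable_def by blast
  ultimately show ?case
    by (simp add: frechet_derivative_at[OF D, symmetric])
qed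

text \<open>
  A linear left inverse \<open>\<psi>\<close> of the chart makes the chart a homeomorphism onto its image and,
  since it is also a left inverse of every derivative, an immersion.
\<close>

lemma connected_codim1_subgroupI:
  fixes L :: "real ^ 'n \<Rightarrow> real \<times> (real ^ 'n)" and \<psi> :: "real \<times> (real ^ 'n) \<Rightarrow> real ^ 'n"
  assumes L: "linear L" and \<psi>: "linear \<psi>"
    and \<psi>L: "\<And>x. \<psi> (L x) = x" and \<psi>w: "\<psi> w = 0" and \<psi>u: "\<psi> u = 0"
    and H: "subgroup H Gn"
    and into: "\<And>x. u + L x + exp (x $ i) *\<^sub>R w \<in> H"
    and onto: "\<And>y. y \<in> H \<Longrightarrow> u + L (\<psi> y) + exp (\<psi> y $ i) *\<^sub>R w = y"
  shows "connected_codim1_subgroup H"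
proof -
  define \<phi> where "\<phi> = (\<lambda>x. u + L x + exp (x $ i) *\<^sub>R w)"
  have \<psi>\<phi>: "\<psi> (\<phi> x) = x" for x
    by (simp add: \<phi>_def linear_add[OF \<psi>] linear_cmul[OF \<psi>] \<psi>L \<psi>w \<psi>u)
  have range: "range \<phi> = H"
  proof
    show "range \<phi> \<subseteq> H"
      using into by (auto simp: \<phi>_def)
    show "H \<subseteq> range \<phi>"
    proof
      fix y assume "y \<in> H"
      then have "y = \<phi> (\<psi> y)"
        using onto by (simp add: \<phi>_def)
      then show "y \<in> range \<phi>" by blast
    qed
  qed
  have cont: "continuous_on UNIV \<phi>"
    using Ck_on_affine_plus_exp[OF L, of 0 UNIV] by (simp add: \<phi>_def)
  have cont\<psi>: "continuous_on A \<psi>" for A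
    using \<psi> by (simp add: linear_continuous_on linear_conv_bounded_linear)
  have homeo: "homeomorphic_map (top_of_set UNIV) (subtopology (top_of_set H) (\<phi> ` UNIV)) \<phi>"
    unfolding homeomorphic_map_maps homeomorphic_maps_def range
  proof (intro exI[of _ \<psi>] conjI ballI)
    show "continuous_map (top_of_set UNIV) (subtopology (top_of_set H) H) \<phi>"
      using cont range by (auto simp: subtopology_subtopology continuous_map_in_subtopology)
    show "continuous_map (subtopology (top_of_set H) H) (top_of_set UNIV) \<psi>"
      using cont\<psi> by (simp add: subtopology_subtopology)
    show "\<phi> (\<psi> y) = y" if "y \<in> topspace (subtopology (top_of_set H) H)" for y
      using that onto by (simp add: \<phi>_def)
  qed (rule \<psi>\<phi>)
  have immersion: "smooth_immersion_on UNIV \<phi>"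
    unfolding smooth_immersion_on_def
  proof (intro conjI allI ballI)
    show "Ck_on k UNIV \<phi>" for k
      unfolding \<phi>_def by (rule Ck_on_affine_plus_exp[OF L])
    fix x
    have D: "frechet_derivative \<phi> (at x) = (\<lambda>h. L h + exp (x $ i) *\<^sub>R ((h $ i) *\<^sub>R w))"
      unfolding \<phi>_def by (rule frechet_derivative_at[symmetric] has_derivative_affine_plus_exp L)+
    have "\<psi> (frechet_derivative \<phi> (at x) h) = h" for h
      by (simp add: D linear_add[OF \<psi>] linear_cmul[OF \<psi>] \<psi>L \<psi>w)
    then show "inj (frechet_derivative \<phi> (at x))"
      by (metis injI)
  qed
  have mult: "continuous_map (prod_topology (top_of_set H) (top_of_set H)) (top_of_set H)
      (\<lambda>(x, y). x \<otimes>\<^bsub>Gn\<^esub> y)"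
  proof -
    have "continuous_on (H \<times> H) (\<lambda>(x, y). (fst x + fst y, snd x + exp (fst x) *\<^sub>R snd y))"
      unfolding case_prod_beta by (intro continuous_intros)
    moreover have "x \<otimes>\<^bsub>Gn\<^esub> y = (fst x + fst y, snd x + exp (fst x) *\<^sub>R snd y)"
      for x y :: "real \<times> (real ^ 'n)"
      by (cases x; cases y) simp
    ultimately have "continuous_on (H \<times> H) (\<lambda>(x, y). x \<otimes>\<^bsub>Gn\<^esub> y)"
      by simp
    then show ?thesis
      using subgroup.m_closed[OF H] by (auto simp del: mult_Gn)
  qed
  have inverse: "continuous_map (top_of_set H) (top_of_set H) (\<lambda>x. inv\<^bsub>Gn\<^esub> x)"
  proof -
    have "continuous_on H (\<lambda>x. (- fst x, - (exp (- fst x) *\<^sub>R snd x)))"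
      by (intro continuous_intros)
    moreover have "inv\<^bsub>Gn\<^esub> x = (- fst x, - (exp (- fst x) *\<^sub>R snd x))"
      for x :: "real \<times> (real ^ 'n)"
      by (cases x) (simp add: inv_Gn)
    ultimately have "continuous_on H (\<lambda>x. inv\<^bsub>Gn\<^esub> x)"
      by simp
    then show ?thesis
      using subgroup.m_inv_closed[OF H] by auto
  qed
  have conn: "connected_space (top_of_set H)"
    using connected_continuous_image[OF cont connected_UNIV] range
    by (simp add: connected_space_subtopology)
  have charts: "\<exists>(V :: (real ^ 'n) set) \<phi>. open V \<and> p \<in> \<phi> ` V \<and> openin (top_of_set H) (\<phi> ` V) \<and>
      homeomorphic_map (top_of_set V) (subtopology (top_of_set H) (\<phi> ` V)) \<phi> \<and>
      smooth_immersion_on V \<phi>" if "p \<in> H" for p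
    using that homeo immersion range
    by (intro exI[of _ UNIV] exI[of _ \<phi>]) auto
  have "second_countable (euclidean :: (real \<times> (real ^ 'n)) topology)"
  proof -
    obtain \<B> :: "(real \<times> (real ^ 'n)) set set" where \<B>: "countable \<B>" "\<And>V. V \<in> \<B> \<Longrightarrow> open V"
      "\<And>U. open U \<Longrightarrow> \<exists>\<V>. \<V> \<subseteq> \<B> \<and> U = \<Union>\<V>"
      using univ_second_countable by metis
    have "\<exists>V\<in>\<B>. x \<in> V \<and> V \<subseteq> U" if "open U" "x \<in> U" for U x
      using \<B>(3)[OF that(1)] that(2) by blast
    with \<B>(1,2) show ?thesis
      unfolding second_countable_def open_openin[symmetric] by blast
  qed
  then have "second_countable (top_of_set H)"
    by (rule second_countable_subtopology)
  moreover have "Hausdorff_space (top_of_set H)"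
    by (simp add: Hausdorff_space_subtopology)
  ultimately show ?thesis
    unfolding connected_codim1_subgroup_def
    using H mult inverse conn charts by (intro conjI exI[of _ "top_of_set H"]) auto
qed

text \<open>
  For \<open>w = (c, l)\<close> with \<open>l \<noteq> 0\<close> the equation \<open>c (1 - exp a) + l \<bullet> b = 0\<close> can be solved for a
  coordinate \<open>b $ i\<close> with \<open>l $ i \<noteq> 0\<close>. The chart uses the slot \<open>i\<close> thus freed to store \<open>a\<close>.
\<close>

lemma connected_codim1_subgroup_cocycle_kernel:
  fixes w :: "real \<times> (real ^ 'n)"
  assumes "w \<noteq> 0"
  shows "connected_codim1_subgroup (cocycle_kernel w)"
proof -
  obtain c l where w: "w = (c, l)" by (cases w)
  have mem: "(a, b) \<in> cocycle_kernel w \<longleftrightarrow> l \<bullet> b = c * (exp a - 1)" for a b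
    by (auto simp: cocycle_kernel_def cocycle_def w algebra_simps)
  show ?thesis
  proof (cases "l = 0")
    case True
    with assms w have "c \<noteq> 0"
      by (simp add: zero_prod_def)
    with mem True have mem0: "(a, b) \<in> cocycle_kernel w \<longleftrightarrow> a = 0" for a b
      by simp
    show ?thesis
    proof (rule connected_codim1_subgroupI[where L = "\<lambda>b. (0, b)" and \<psi> = snd and w = 0 and u = 0])
      show "linear (\<lambda>b::real^'n. (0::real, b))"
        by (intro linearI) auto
      show "linear (snd :: real \<times> (real^'n) \<Rightarrow> _)"
        by (rule linear_snd)
    qed (auto simp: subgroup_cocycle_kernel mem0)
  next
    case False
    then obtain i where i: "l $ i \<noteq> 0"
      by (auto simp: vec_eq_iff)
    define e where "e = (axis i 1 :: real ^ 'n)"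
    have e [simp]: "e $ i = 1" "l \<bullet> e = l $ i"
      by (auto simp: e_def inner_axis)
    define Q where "Q = (\<lambda>x::real^'n. x - (x $ i) *\<^sub>R e)"
    have Q: "linear Q"
      by (intro linearI) (auto simp: Q_def algebra_simps)
    have Q_i [simp]: "Q x $ i = 0" for x
      by (simp add: Q_def)
    define L where "L = (\<lambda>x. (x $ i, Q x - (l \<bullet> Q x / l $ i) *\<^sub>R e))"
    define \<psi> where "\<psi> = (\<lambda>y::real \<times> (real^'n). snd y + (fst y - snd y $ i) *\<^sub>R e)"
    define u where "u = (0 :: real, - ((c / l $ i) *\<^sub>R e))"
    define w' where "w' = (0 :: real, (c / l $ i) *\<^sub>R e)"
    show ?thesis
    proof (rule connected_codim1_subgroupI[where L = L and \<psi> = \<psi> and w = w' and u = u and i = i])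
      show "linear L"
        by (intro linearI)
          (auto simp: L_def linear_add[OF Q] linear_cmul[OF Q] inner_add_right add_divide_distrib
            algebra_simps)
      show "linear \<psi>"
        by (intro linearI) (auto simp: \<psi>_def algebra_simps)
      show "\<psi> (L x) = x" for x
        by (simp add: \<psi>_def L_def algebra_simps) (simp add: Q_def)
      show "\<psi> w' = 0" "\<psi> u = 0"
        by (auto simp: \<psi>_def w'_def u_def)
      show "subgroup (cocycle_kernel w) Gn"
        by (rule subgroup_cocycle_kernel)
      show "u + L x + exp (x $ i) *\<^sub>R w' \<in> cocycle_kernel w" for x
        using i by (simp add: L_def u_def w'_def mem inner_add_right inner_diff_right algebra_simps)
      show "u + L (\<psi> y) + exp (\<psi> y $ i) *\<^sub>R w' = y" if "y \<in> cocycle_kernel w" for y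
      proof -
        obtain a b where y: "y = (a, b)" by (cases y)
        have eq: "l \<bullet> b = c * (exp a - 1)"
          using that mem y by simp
        have \<psi>i: "\<psi> y $ i = a"
          by (simp add: \<psi>_def y)
        have Q\<psi>: "Q (\<psi> y) = b - (b $ i) *\<^sub>R e"
          by (simp add: Q_def \<psi>i) (simp add: \<psi>_def y algebra_simps)
        have lQ: "l \<bullet> Q (\<psi> y) = c * (exp a - 1) - b $ i * l $ i"
          by (simp add: Q\<psi> inner_diff_right eq)
        have "- (c / l $ i) - l \<bullet> Q (\<psi> y) / l $ i + exp a * (c / l $ i) = b $ i"
          unfolding lQ using i by (simp add: field_simps)
        moreover have "u + L (\<psi> y) + exp (\<psi> y $ i) *\<^sub>R w' =
            (a, Q (\<psi> y) + (- (c / l $ i) - l \<bullet> Q (\<psi> y) / l $ i + exp a * (c / l $ i)) *\<^sub>R e)"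
          by (simp add: L_def u_def w'_def \<psi>i algebra_simps)
        ultimately show ?thesis
          using Q\<psi> y by simp
      qed
    qed
  qed
qed

text \<open>
  The intrinsic topology may be finer than the subspace topology, but it is second countable,
  so countably many charts suffice; each of them is a null set for dimension reasons.
\<close>

lemma negligible_connected_codim1_subgroup:
  fixes H :: "(real \<times> (real ^ 'n)) set"
  assumes "connected_codim1_subgroup H"
  shows "negligible H"
proof -
  obtain T where T: "topspace T = H" "second_countable T"
    and charts: "\<forall>p\<in>H. \<exists>(V :: (real ^ 'n) set) \<phi>. open V \<and> p \<in> \<phi> ` V \<and> openin T (\<phi> ` V) \<and>
      homeomorphic_map (top_of_set V) (subtopology T (\<phi> ` V)) \<phi> \<and> smooth_immersion_on V \<phi>"
    using assms unfolding connected_codim1_subgroup_def by blast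
  define \<U> where "\<U> = {U. openin T U \<and> negligible U}"
  have "p \<in> \<Union>\<U>" if p: "p \<in> H" for p
  proof -
    obtain V :: "(real ^ 'n) set" and \<phi>
      where V: "p \<in> \<phi> ` V" "openin T (\<phi> ` V)" "smooth_immersion_on V \<phi>"
      using charts p by blast
    have "Ck_on 1 V \<phi>"
      using V(3) unfolding smooth_immersion_on_def by blast
    then have "\<phi> differentiable_on V"
      by (auto simp: differentiable_on_def intro: differentiable_at_withinI)
    then have "negligible (\<phi> ` V)"
      by (intro negligible_differentiable_image_lowdim) auto
    then show ?thesis
      using V by (auto simp: \<U>_def)
  qed
  moreover have "\<Union>\<U> \<subseteq> topspace T"
    by (auto simp: \<U>_def dest: openin_subset)
  ultimately have "\<Union>\<U> = topspace T"
    using T by blast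
  moreover have "\<forall>U\<in>\<U>. openin T U"
    by (simp add: \<U>_def)
  ultimately have "\<exists>\<V>. countable \<V> \<and> \<V> \<subseteq> \<U> \<and> \<Union>\<V> = topspace T"
    using second_countable_imp_Lindelof_space[OF T(2)] by (simp add: Lindelof_space_def)
  then obtain \<V> where \<V>: "countable \<V>" "\<V> \<subseteq> \<U>" "\<Union>\<V> = topspace T"
    by blast
  then have "negligible (\<Union>\<V>)"
    by (intro negligible_countable_Union) (auto simp: \<U>_def)
  with \<V> T show ?thesis
    by simp
qed

lemma mult_quasi_dense_if_mult_dense:
  assumes "mult_dense S"
  shows "mult_quasi_dense S"
proof -
  have "\<not> connected_codim1_subgroup (UNIV :: (real \<times> (real ^ 'n)) set)"
    using negligible_connected_codim1_subgroup non_negligible_UNIV by blast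
  moreover have "subgroup UNIV (Gn :: (real \<times> (real ^ 'n)) monoid)"
    using group.subgroup_self[OF group_Gn] by simp
  ultimately show ?thesis
    using assms by (simp add: mult_dense_def mult_quasi_dense_def top.extremum_unique)
qed


section \<open>The lower bound\<close>

lemma closure_semigroup_span_nonneg:
  fixes f :: "real \<times> (real ^ 'n) \<Rightarrow> real"
  assumes f: "linear f" and pos: "\<And>x. x \<in> S \<Longrightarrow> f (cocycle x) > 0"
    and y: "y \<in> closure (semigroup_span Gn S)"
  shows "f (cocycle y) \<ge> 0"
proof -
  have "f (cocycle x) > 0" if "x \<in> semigroup_span Gn S" for x
    using that
  proof (induction rule: semigroup_span.induct)
    case (mult x y)
    then show ?case
      by (simp add: cocycle_mult linear_add[OF f] linear_cmul[OF f] add_pos_pos)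
  qed (rule pos)
  then have "semigroup_span Gn S \<subseteq> {y. 0 \<le> f (cocycle y)}"
    by (simp add: subset_eq less_imp_le del: split_paired_All)
  moreover have "continuous_on UNIV (\<lambda>y. f (cocycle y))"
    using f by (intro continuous_on_compose2[OF linear_continuous_on[of f UNIV] continuous_on_cocycle])
      (auto simp: linear_conv_bounded_linear)
  then have "closed {y. 0 \<le> f (cocycle y)}"
    by (intro closed_Collect_le continuous_intros) auto
  ultimately have "closure (semigroup_span Gn S) \<subseteq> {y. 0 \<le> f (cocycle y)}"
    by (rule closure_minimal)
  with y show ?thesis
    by auto
qed

theorem card_ge_if_mult_quasi_dense:
  fixes S :: "(real \<times> (real ^ 'n)) set"
  assumes fin: "finite S" and S: "mult_quasi_dense S"
  shows "CARD('n) + 2 \<le> card S"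
proof (rule ccontr)
  assume "\<not> CARD('n) + 2 \<le> card S"
  then have card: "card S \<le> CARD('n) + 1" by simp
  let ?\<Gamma> = "closure (semigroup_span Gn S)"
  have \<Gamma>: "subgroup ?\<Gamma> Gn"
    and no: "\<And>H. connected_codim1_subgroup H \<Longrightarrow> \<not> ?\<Gamma> \<subseteq> H"
    using S unfolding mult_quasi_dense_def by blast+
  have "semigroup_span Gn S \<noteq> {}"
    using subgroup.one_closed[OF \<Gamma>] by auto
  moreover have "semigroup_span Gn S = {}" if "S = {}"
  proof -
    have "x \<in> semigroup_span Gn S \<Longrightarrow> False" for x
      by (induction rule: semigroup_span.induct) (use that in auto)
    then show ?thesis by blast
  qed
  ultimately obtain x where x: "x \<in> S" by blast
  show False
  proof (cases "span (cocycle ` S) = UNIV")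
    case True
    have "card (cocycle ` S) \<le> dim (UNIV :: (real \<times> (real ^ 'n)) set)"
      using card card_image_le[OF fin, of cocycle] by simp
    then have "independent (cocycle ` S)"
      using True fin by (intro card_le_dim_spanning[of _ UNIV]) auto
    then obtain f :: "real \<times> (real ^ 'n) \<Rightarrow> real"
      where f: "linear f" and f1: "\<And>z. z \<in> cocycle ` S \<Longrightarrow> f z = 1"
      using linear_independent_extend[of "cocycle ` S" "\<lambda>_. 1"] by blast
    have "inv\<^bsub>Gn\<^esub> x \<in> ?\<Gamma>"
      using subgroup.m_inv_closed[OF \<Gamma>] semigroup_span.base[OF x] closure_subset by blast
    then have "f (cocycle (inv\<^bsub>Gn\<^esub> x)) \<ge> 0"
      using f f1 by (intro closure_semigroup_span_nonneg[of f S]) auto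
    moreover have "f (cocycle (inv\<^bsub>Gn\<^esub> x)) = - exp (- fst x)"
      using f1 x by (simp add: cocycle_inv linear_neg[OF f] linear_cmul[OF f])
    ultimately show False by simp
  next
    case False
    then obtain w where w: "w \<noteq> 0" and perp: "\<And>z. z \<in> span (cocycle ` S) \<Longrightarrow> w \<bullet> z = 0"
      using span_not_UNIV_orthogonal by blast
    have "x \<in> cocycle_kernel w" if "x \<in> semigroup_span Gn S" for x
      using that
    proof (induction rule: semigroup_span.induct)
      case (base x)
      then show ?case
        by (simp add: cocycle_kernel_def perp span_base)
    next
      case (mult x y)
      then show ?case
        using subgroup.m_closed[OF subgroup_cocycle_kernel] by blast
    qed
    then have "?\<Gamma> \<subseteq> cocycle_kernel w"
      by (intro closure_minimal closed_cocycle_kernel) blast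
    then show False
      using no connected_codim1_subgroup_cocycle_kernel[OF w] by blast
  qed
qed


section \<open>A dense semigroup with n + 2 generators\<close>

text \<open>
  Both numbers can be made large: the approximation theorem for the irrational number \<open>M \<theta>\<close>
  provides a multiple of \<open>M\<close> for \<open>m\<close>, and \<open>k\<close> is then large because \<open>m \<theta>\<close> is.
\<close>

lemma irrational_combination_approx:
  fixes \<theta> t \<epsilon> :: real and N :: nat
  assumes \<theta>: "\<theta> \<notin> \<rat>" "\<theta> > 0" and \<epsilon>: "\<epsilon> > 0"
  obtains m k :: nat where "m > 0" "k \<ge> N" "\<bar>real m * \<theta> - real k - t\<bar> < \<epsilon>"
proof -
  obtain M :: nat where M: "real M > (real N + \<bar>t\<bar> + \<epsilon>) / \<theta>"
    using reals_Archimedean2 by blast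
  have "(real N + \<bar>t\<bar> + \<epsilon>) / \<theta> \<ge> 0"
    using \<theta> \<epsilon> by simp
  with M have M0: "real M > 0" by linarith
  have "real M * \<theta> \<notin> \<rat>"
  proof
    assume "real M * \<theta> \<in> \<rat>"
    then have "real M * \<theta> / real M \<in> \<rat>"
      by (intro Rats_divide) auto
    with M0 \<theta> show False by simp
  qed
  then obtain h q where q: "q > 0" and *: "\<bar>of_int q * (real M * \<theta>) - of_int h - t\<bar> < \<epsilon>"
    using sequence_of_fractional_parts_is_dense[OF _ \<epsilon>] by metis
  have "real M * \<theta> > real N + \<bar>t\<bar> + \<epsilon>"
    using M \<theta> by (simp add: field_simps)
  moreover have "of_int q * (real M * \<theta>) \<ge> 1 * (real M * \<theta>)"
    using q M0 \<theta> by (intro mult_right_mono) auto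
  ultimately have "of_int h > real N"
    using * by linarith
  then have h: "h \<ge> int N" by linarith
  show ?thesis
  proof
    show "nat q * M > 0" using q M0 by simp
    show "nat h \<ge> N" using h by simp
    show "\<bar>real (nat q * M) * \<theta> - real (nat h) - t\<bar> < \<epsilon>"
      using * q h by (simp add: mult.assoc)
  qed
qed

lemma closure_semigroup_span_mult:
  fixes S :: "(real \<times> (real ^ 'n)) set"
  assumes "x \<in> closure (semigroup_span Gn S)" "y \<in> closure (semigroup_span Gn S)"
  shows "x \<otimes>\<^bsub>Gn\<^esub> y \<in> closure (semigroup_span Gn S)"
proof -
  obtain f g where f: "\<And>k::nat. f k \<in> semigroup_span Gn S" "f \<longlonglongrightarrow> x"
    and g: "\<And>k::nat. g k \<in> semigroup_span Gn S" "g \<longlonglongrightarrow> y"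
    using assms unfolding closure_sequential by blast
  have "x \<otimes>\<^bsub>Gn\<^esub> y = (fst x + fst y, snd x + exp (fst x) *\<^sub>R snd y)"
    for x y :: "real \<times> (real ^ 'n)"
    by (cases x; cases y) simp
  then have "(\<lambda>k. f k \<otimes>\<^bsub>Gn\<^esub> g k) \<longlonglongrightarrow> x \<otimes>\<^bsub>Gn\<^esub> y"
    using f(2) g(2) by (auto intro!: tendsto_intros)
  moreover have "f k \<otimes>\<^bsub>Gn\<^esub> g k \<in> semigroup_span Gn S" for k
    using f(1) g(1) by (rule semigroup_span.mult)
  ultimately show ?thesis
    unfolding closure_sequential by (intro exI[of _ "\<lambda>k. f k \<otimes>\<^bsub>Gn\<^esub> g k"]) simp
qed

lemma pure_dilation_power:
  assumes "(\<beta>, 0) \<in> S" "m > 0"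
  shows "(real m * \<beta>, 0) \<in> semigroup_span Gn S"
  using assms(2)
proof (induction m rule: nat_induct_non_zero)
  case 1
  then show ?case using assms(1) by (simp add: semigroup_span.base)
next
  case (Suc m)
  from semigroup_span.mult[OF semigroup_span.base[OF assms(1)] Suc.IH]
  show ?case by (simp add: algebra_simps)
qed

text \<open>
  If the similarities \<open>y \<mapsto> exp \<alpha> \<cdot> y + b j\<close> map \<open>C\<close> onto a cover of \<open>C\<close>, then so do
  their words of each length \<open>k\<close>, and a point of \<open>C\<close> is in the image of \<open>C\<close> under some word.
\<close>

lemma self_covering_words:
  fixes C :: "(real ^ 'n) set" and b :: "'j \<Rightarrow> real ^ 'n"
  assumes gens: "\<And>j. (\<alpha>, b j) \<in> S"
    and cover: "\<And>x. x \<in> C \<Longrightarrow> \<exists>j. \<exists>y\<in>C. x = b j + exp \<alpha> *\<^sub>R y"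
    and k: "k > 0" and x: "x \<in> C"
  shows "\<exists>t. \<exists>y\<in>C. (real k * \<alpha>, t) \<in> semigroup_span Gn S \<and> x = t + exp (real k * \<alpha>) *\<^sub>R y"
  using k x
proof (induction k arbitrary: x rule: nat_induct_non_zero)
  case 1
  obtain j y where "y \<in> C" "x = b j + exp \<alpha> *\<^sub>R y"
    using cover[OF 1] by blast
  then show ?case
    using semigroup_span.base[OF gens, of j Gn]
    by (intro exI[of _ "b j"] bexI[of _ y]) auto
next
  case (Suc k)
  obtain j z where z: "z \<in> C" "x = b j + exp \<alpha> *\<^sub>R z"
    using cover[OF Suc.prems] by blast
  obtain t y where ty: "y \<in> C" "(real k * \<alpha>, t) \<in> semigroup_span Gn S"
      "z = t + exp (real k * \<alpha>) *\<^sub>R y"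
    using Suc.IH[OF z(1)] by blast
  have "(real (Suc k) * \<alpha>, b j + exp \<alpha> *\<^sub>R t) \<in> semigroup_span Gn S"
    using semigroup_span.mult[OF semigroup_span.base[OF gens, of j] ty(2)]
    by (simp add: algebra_simps)
  moreover have "x = (b j + exp \<alpha> *\<^sub>R t) + exp (real (Suc k) * \<alpha>) *\<^sub>R y"
    unfolding z(2) ty(3) by (simp add: exp_add algebra_simps)
  ultimately show ?case
    using ty(1) by blast
qed

text \<open>
  The dilation stands to the right of the word. This is what keeps the translation part of the
  word; on the left it would magnify the error \<open>exp (k \<alpha>)\<close> as fast as that error decays.
\<close>

lemma mem_closure_if_self_covering:
  fixes C :: "(real ^ 'n) set" and b :: "'j \<Rightarrow> real ^ 'n"
  assumes gens: "\<And>j. (\<alpha>, b j) \<in> S" and dil: "(- \<theta> * \<alpha>, 0) \<in> S"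
    and \<alpha>: "\<alpha> < 0" and \<theta>: "\<theta> \<notin> \<rat>" "\<theta> > 0"
    and bounded: "bounded C"
    and cover: "\<And>x. x \<in> C \<Longrightarrow> \<exists>j. \<exists>y\<in>C. x = b j + exp \<alpha> *\<^sub>R y"
    and x: "x \<in> C"
  shows "(a, x) \<in> closure (semigroup_span Gn S)"
  unfolding closure_approachable
proof (intro allI impI)
  fix \<epsilon> :: real assume \<epsilon>: "\<epsilon> > 0"
  obtain B where B: "B > 0" "\<And>y. y \<in> C \<Longrightarrow> norm y \<le> B"
    using bounded bounded_pos by blast
  have "(\<lambda>k. exp \<alpha> ^ k) \<longlonglongrightarrow> 0"
    using \<alpha> by (intro LIMSEQ_realpow_zero) auto
  then have "\<forall>\<^sub>F k in sequentially. exp \<alpha> ^ k < \<epsilon> / (2 * B)"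
    using \<epsilon> B by (intro order_tendstoD) auto
  then obtain N where N: "\<And>k. k \<ge> N \<Longrightarrow> exp \<alpha> ^ k < \<epsilon> / (2 * B)"
    unfolding eventually_sequentially by blast
  have "\<epsilon> / (2 * \<bar>\<alpha>\<bar>) > 0"
    using \<epsilon> \<alpha> by (intro divide_pos_pos mult_pos_pos) auto
  from irrational_combination_approx[OF \<theta> this, where N = "Suc N" and t = "a / \<bar>\<alpha>\<bar>"]
  obtain m k where m: "m > 0" and k: "k \<ge> Suc N"
    and mk: "\<bar>real m * \<theta> - real k - a / \<bar>\<alpha>\<bar>\<bar> < \<epsilon> / (2 * \<bar>\<alpha>\<bar>)" by blast
  obtain t y where ty: "y \<in> C" "(real k * \<alpha>, t) \<in> semigroup_span Gn S"
      "x = t + exp (real k * \<alpha>) *\<^sub>R y"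
    using self_covering_words[of \<alpha> b S C k x, OF gens cover] k x by auto
  let ?z = "(real k * \<alpha> + real m * (- \<theta> * \<alpha>), t)"
  have "?z \<in> semigroup_span Gn S"
    using semigroup_span.mult[OF ty(2) pure_dilation_power[OF dil m]] by simp
  moreover have "dist ?z (a, x) < \<epsilon>"
  proof -
    have "real k * \<alpha> + real m * (- \<theta> * \<alpha>) - a = \<bar>\<alpha>\<bar> * (real m * \<theta> - real k - a / \<bar>\<alpha>\<bar>)"
      using \<alpha> by (simp add: field_simps)
    then have "\<bar>real k * \<alpha> + real m * (- \<theta> * \<alpha>) - a\<bar>
        = \<bar>\<alpha>\<bar> * \<bar>real m * \<theta> - real k - a / \<bar>\<alpha>\<bar>\<bar>"
      by (simp add: abs_mult)
    also have "\<dots> < \<bar>\<alpha>\<bar> * (\<epsilon> / (2 * \<bar>\<alpha>\<bar>))"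
      using mk \<alpha> by (intro mult_strict_left_mono) auto
    also have "\<dots> = \<epsilon> / 2"
      using \<alpha> by simp
    finally have 1: "dist (real k * \<alpha> + real m * (- \<theta> * \<alpha>)) a < \<epsilon> / 2"
      by (simp add: dist_real_def)
    have "dist t x = exp (real k * \<alpha>) * norm y"
      by (simp add: ty(3) dist_norm)
    also have "\<dots> \<le> exp (real k * \<alpha>) * B"
      using B ty(1) by simp
    also have "\<dots> = exp \<alpha> ^ k * B"
      by (simp add: exp_of_nat_mult)
    also have "\<dots> < \<epsilon> / (2 * B) * B"
      using N[of k] k B by (intro mult_strict_right_mono) auto
    also have "\<dots> = \<epsilon> / 2"
      using B by simp
    finally have 2: "dist t x < \<epsilon> / 2" .
    have "dist ?z (a, x) \<le> dist (real k * \<alpha> + real m * (- \<theta> * \<alpha>)) a + dist t x"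
      unfolding dist_Pair_Pair by (rule sqrt_sum_squares_le_sum) auto
    with 1 2 show ?thesis by linarith
  qed
  ultimately show "\<exists>z\<in>semigroup_span Gn S. dist z (a, x) < \<epsilon>"
    by blast
qed

text \<open>
  The identity \<open>(s, 0) (a - s, exp (- s) b) = (a, b)\<close> with large \<open>s\<close> reduces an arbitrary
  translation part to a small one.
\<close>

lemma mult_dense_if_self_covering:
  fixes C :: "(real ^ 'n) set" and b :: "'j \<Rightarrow> real ^ 'n"
  assumes gens: "\<And>j. (\<alpha>, b j) \<in> S" and dil: "(- \<theta> * \<alpha>, 0) \<in> S"
    and \<alpha>: "\<alpha> < 0" and \<theta>: "\<theta> \<notin> \<rat>" "\<theta> > 0"
    and bounded: "bounded C"
    and cover: "\<And>x. x \<in> C \<Longrightarrow> \<exists>j. \<exists>y\<in>C. x = b j + exp \<alpha> *\<^sub>R y"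
    and zero: "\<delta> > 0" "ball 0 \<delta> \<subseteq> C"
  shows "mult_dense S"
  unfolding mult_dense_def
proof -
  have in_closure: "(a, x) \<in> closure (semigroup_span Gn S)" if "x \<in> C" for a x
    by (rule mem_closure_if_self_covering[where b = b and C = C])
      (rule gens dil \<alpha> \<theta> bounded that | erule cover)+
  have "(a, v) \<in> closure (semigroup_span Gn S)" for a v
  proof -
    define s where "s = ln (norm v / \<delta> + 1)"
    have s: "exp s = norm v / \<delta> + 1"
      unfolding s_def using zero by (intro exp_ln) (simp add: add_nonneg_pos)
    have "norm (exp (- s) *\<^sub>R v) = norm v / exp s"
      by (simp add: exp_minus divide_inverse)
    also have "\<dots> < \<delta>"
      using s zero by (simp add: divide_simps) (simp add: algebra_simps)
    finally have "exp (- s) *\<^sub>R v \<in> C"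
      using zero by auto
    then have "(a - s, exp (- s) *\<^sub>R v) \<in> closure (semigroup_span Gn S)"
      by (rule in_closure)
    moreover have "(s, 0) \<in> closure (semigroup_span Gn S)"
      using zero by (intro in_closure) auto
    ultimately have "(s, 0) \<otimes>\<^bsub>Gn\<^esub> (a - s, exp (- s) *\<^sub>R v) \<in> closure (semigroup_span Gn S)"
      by (intro closure_semigroup_span_mult)
    then show ?thesis
      by (simp flip: exp_add)
  qed
  then show "closure (semigroup_span Gn S) = UNIV"
    by auto
qed

text \<open>
  The simplex \<open>x $ i \<ge> -1\<close>, \<open>\<Sum>i. x $ i \<le> 1\<close> has barycentric coordinates \<open>x $ i + 1\<close> and
  \<open>1 - (\<Sum>i. x $ i)\<close>, of sum \<open>n + 1\<close>. The contraction with index \<open>j\<close> multiplies them by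
  \<open>n / (n+1)\<close> and adds 1 to the one with index \<open>j\<close>, so it maps the simplex onto the part where that
  coordinate is at least 1.
\<close>

definition centred_simplex :: "(real ^ 'n) set" where
  "centred_simplex = {x. (\<forall>i. x $ i \<ge> -1) \<and> (\<Sum>i\<in>UNIV. x $ i) \<le> 1}"

definition simplex_shift :: "'n option \<Rightarrow> real ^ 'n" where
  "simplex_shift j = (\<chi> i. (if j = Some i then 1 else 0) - 1 / (real CARD('n) + 1))"

lemma bounded_simplex: "bounded (centred_simplex :: (real ^ 'n) set)"
proof -
  have "norm x \<le> real CARD('n) * (real CARD('n) + 1)" if "x \<in> centred_simplex" for x :: "real ^ 'n"
  proof -
    have "\<bar>x $ i\<bar> \<le> real CARD('n) + 1" for i
    proof -
      have lower: "x $ j + 1 \<ge> 0" for j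
        using that by (auto simp: centred_simplex_def add.commute dest!: spec[of _ j])
      have "x $ i + 1 \<le> (\<Sum>i\<in>UNIV. x $ i + 1)"
        using lower by (intro member_le_sum) auto
      also have "\<dots> \<le> 1 + real CARD('n)"
        using that by (simp add: centred_simplex_def sum.distrib)
      finally have "x $ i + 1 \<le> 1 + real CARD('n)" .
      then show ?thesis using lower[of i] by linarith
    qed
    then have "(\<Sum>i\<in>UNIV. \<bar>x $ i\<bar>) \<le> of_nat CARD('n) * (real CARD('n) + 1)"
      by (intro sum_bounded_above)
    then show ?thesis
      using norm_le_l1_cart[of x] by linarith
  qed
  then show ?thesis
    by (auto simp: bounded_iff)
qed

lemma ball_subset_simplex: "ball 0 (1 / real CARD('n)) \<subseteq> (centred_simplex :: (real ^ 'n) set)"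
proof
  fix x :: "real ^ 'n" assume "x \<in> ball 0 (1 / real CARD('n))"
  then have "\<bar>x $ i\<bar> \<le> 1 / real CARD('n)" for i
    using component_le_norm_cart[of x i] by auto
  moreover have "1 / real CARD('n) \<le> 1"
    by simp
  ultimately have i: "\<bar>x $ i\<bar> \<le> 1 / real CARD('n)" "\<bar>x $ i\<bar> \<le> 1" for i
    by (meson order_trans)+
  have "(\<Sum>i\<in>UNIV. x $ i) \<le> of_nat CARD('n) * (1 / real CARD('n))"
    using i by (intro sum_bounded_above) (meson abs_le_D1)
  moreover have "x $ j \<ge> -1" for j
    using i(2)[of j] by linarith
  ultimately show "x \<in> centred_simplex"
    by (auto simp: centred_simplex_def)
qed

lemma simplex_self_covering:
  fixes x :: "real ^ 'n"
  assumes x: "x \<in> centred_simplex"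
  shows "\<exists>j. \<exists>y\<in>centred_simplex. x = simplex_shift j + (real CARD('n) / (real CARD('n) + 1)) *\<^sub>R y"
proof -
  define n where "n = real CARD('n)"
  have n: "n > 0" by (simp add: n_def)
  have xi: "x $ i \<ge> -1" for i
    using x by (auto simp: centred_simplex_def)
  have xs: "(\<Sum>i\<in>UNIV. x $ i) \<le> 1"
    using x by (auto simp: centred_simplex_def)
  define y where "y j = ((n + 1) / n) *\<^sub>R (x - simplex_shift j)" for j
  have eq: "x = simplex_shift j + (n / (n + 1)) *\<^sub>R y j" for j
    using n by (simp add: y_def)
  have yi: "y j $ i = ((n + 1) * x $ i + 1 - (if j = Some i then n + 1 else 0)) / n" for i j
    using n by (simp add: y_def simplex_shift_def flip: n_def) (simp add: field_simps)
  have ys: "(\<Sum>i\<in>UNIV. y j $ i) =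
      ((n + 1) * (\<Sum>i\<in>UNIV. x $ i) + n - (if j = None then 0 else n + 1)) / n" for j
  proof -
    have "(\<Sum>i\<in>UNIV. if j = Some i then n + 1 else 0) = (if j = None then 0 else n + 1)"
      by (cases j) auto
    then show ?thesis
      unfolding yi
      by (simp add: sum_divide_distrib[symmetric] sum.distrib sum_subtractf sum_distrib_left[symmetric]
          flip: n_def)
  qed
  have lower: "((n + 1) * x $ i + 1) / n \<ge> -1" for i
    using n mult_left_mono[OF xi, of "n + 1" i] by (simp add: field_simps)
  \<comment> \<open>The barycentric coordinates have sum \<open>n + 1\<close>, so one of the \<open>n + 1\<close> of them is at least 1.\<close>
  show ?thesis
  proof (cases "\<exists>i. x $ i \<ge> 0")
    case True
    then obtain k where k: "x $ k \<ge> 0" by blast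
    have "y (Some k) $ i \<ge> -1" for i
    proof (cases "i = k")
      case True
      then show ?thesis
        using n k by (simp add: yi field_simps)
    next
      case False
      then show ?thesis using lower by (simp add: yi)
    qed
    moreover have "(\<Sum>i\<in>UNIV. y (Some k) $ i) \<le> 1"
      using n mult_left_mono[OF xs, of "n + 1"] by (simp add: ys field_simps)
    ultimately have "y (Some k) \<in> centred_simplex"
      by (simp add: centred_simplex_def)
    then show ?thesis
      using eq unfolding n_def by blast
  next
    case False
    then have "(\<Sum>i\<in>UNIV. x $ i) \<le> 0"
      by (intro sum_nonpos) (auto simp: not_le intro: less_imp_le)
    then have "(n + 1) * (\<Sum>i\<in>UNIV. x $ i) \<le> 0"
      using n by (intro mult_nonneg_nonpos) auto
    then have "(\<Sum>i\<in>UNIV. y None $ i) \<le> 1"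
      using n by (simp add: ys)
    then have "y None \<in> centred_simplex"
      using lower by (simp add: centred_simplex_def yi)
    then show ?thesis
      using eq unfolding n_def by blast
  qed
qed

theorem mult_dense_simplex_generators:
  "\<exists>S :: (real \<times> (real ^ 'n)) set. finite S \<and> card S = CARD('n) + 2 \<and> mult_dense S"
proof -
  have "uncountable ({0<..<1} :: real set)"
    by (simp add: uncountable_open_interval)
  then have "\<not> {0<..<1} \<subseteq> (\<rat> :: real set)"
    using countable_rat countable_subset by blast
  then obtain \<theta> :: real where "\<theta> \<in> {0<..<1}" "\<theta> \<notin> \<rat>"
    by blast
  then have \<theta>: "\<theta> \<notin> \<rat>" "\<theta> > 0"
    by auto
  define \<alpha> where "\<alpha> = ln (real CARD('n) / (real CARD('n) + 1))"
  have \<alpha>: "\<alpha> < 0" and exp: "exp \<alpha> = real CARD('n) / (real CARD('n) + 1)"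
    by (auto simp: \<alpha>_def)
  define C where "C = range (\<lambda>j :: 'n option. (\<alpha>, simplex_shift j))"
  define S where "S = insert (- \<theta> * \<alpha>, 0) C"
  have "inj (\<lambda>j :: 'n option. (\<alpha>, simplex_shift j))"
  proof
    fix j k :: "'n option" assume "(\<alpha>, simplex_shift j) = (\<alpha>, simplex_shift k)"
    then have "(j = Some i) = (k = Some i)" for i
      by (auto simp: simplex_shift_def vec_eq_iff split: if_splits)
    then show "j = k"
      by (metis option.exhaust)
  qed
  then have "card C = CARD('n) + 1"
    by (simp add: C_def card_image card_option)
  moreover have "- \<theta> * \<alpha> > 0"
    using \<alpha> \<theta> by (simp add: mult_pos_neg)
  then have "(- \<theta> * \<alpha>, 0) \<notin> C"
    using \<alpha> by (auto simp: C_def)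
  ultimately have "finite S" "card S = CARD('n) + 2"
    by (auto simp: S_def C_def)
  moreover have "mult_dense S"
  proof (rule mult_dense_if_self_covering)
    show "(\<alpha>, simplex_shift j) \<in> S" for j
      by (auto simp: S_def C_def)
    show "(- \<theta> * \<alpha>, 0) \<in> S"
      by (simp add: S_def)
    show "\<exists>j. \<exists>y\<in>centred_simplex. x = simplex_shift j + exp \<alpha> *\<^sub>R y" if "x \<in> centred_simplex"
      for x :: "real ^ 'n"
      unfolding exp by (rule simplex_self_covering[OF that])
    show "ball 0 (1 / real CARD('n)) \<subseteq> (centred_simplex :: (real ^ 'n) set)"
      by (rule ball_subset_simplex)
  qed (use \<alpha> \<theta> bounded_simplex in auto)
  ultimately show ?thesis by blast
qed

theorem proposition4p1:
  shows "smallest_size (mult_quasi_dense :: (real \<times> (real ^ 'n)) set \<Rightarrow> bool) (CARD('n) + 2)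
    \<and> smallest_size (mult_dense :: (real \<times> (real ^ 'n)) set \<Rightarrow> bool) (CARD('n) + 2)"
  unfolding smallest_size_def
  using mult_dense_simplex_generators card_ge_if_mult_quasi_dense mult_quasi_dense_if_mult_dense
  by blast

end
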